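(* Let $f:\mathbf{N}\to(0,\infty)$ be a definitively non-increasing function such that $\sum_{n\ge1}f(n)=\infty$. Define the summable ideal $$ \mathcal{I}_f:=\left\{S\subseteq\mathbf{N}:\sum_{n\in S}f(n)<\infty\right\}. $$ Then $\mathcal{I}_f$ is thinnable provided $\mathcal{I}_f$ is strechable. In addition, suppose that $$ \liminf_{n\to\infty}\frac{\sum_{i\in[1,n]}f(i)}{\sum_{i\in[1,kn]}f(i)}\neq0\quad\text{for all }k\in\mathbf{N} $$ and define the Erd\H{o}s--Ulam ideal $$ \mathscr{E}_f:=\left\{S\subseteq\mathbf{N}:\lim_{n\to\infty}\frac{\sum_{i\in S\cap[1,n]}f(i)}{\sum_{i\in[1,n]}f(i)}=0\right\}. $$ Then $\mathscr{E}_f$ is thinnable provided $\mathscr{E}_f$ is strechable.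
   Context: $\mathbf{N}$ denotes the set of positive integers, and sums over $i\in[1,n]$ range over integers $i$. "Definitively non-increasing" means eventually non-increasing: there is $n_0$ such that $f(n+1)\le f(n)$ for all $n\ge n_0$. An ideal $\mathcal{I}$ on $\mathbf{N}$ is a family of subsets of $\mathbf{N}$ closed under finite unions and under taking subsets of its elements; it is always assumed that $\mathcal{I}$ contains all finite subsets of $\mathbf{N}$ and that $\mathcal{I}$ is different from the whole power set of $\mathbf{N}$. For $k\in\mathbf{N}$ and infinite sets $A,B\subseteq\mathbf{N}$ with canonical (increasing) enumerations $\{a_n:n\in\mathbf{N}\}$ and $\{b_n:n\in\mathbf{N}\}$, write $A\le B$ if $a_n\le b_n$ for all $n\in\mathbf{N}$, and define $A_B:=\{a_b:b\in B\}$ and $kA:=\{ka:a\in A\}$. A set $A\subseteq\mathbf{N}$ admits non-zero asymptotic density if the limit $\lim_{n\to\infty}|A\cap[1,n]|/n$ exists and is positive. An ideal $\mathcal{I}$ is weakly thinnable if $A_B\notin\mathcal{I}$ whenever $A\subseteq\mathbf{N}$ admits non-zero asymptotic density and $B\notin\mathcal{I}$. An ideal $\mathcal{I}$ is thinnable if it is weakly thinnable and, in addition: (i) $B_A\notin\mathcal{I}$ whenever $A\subseteq\mathbf{N}$ admits non-zero asymptotic density and $B\notin\mathcal{I}$; and (ii) $X\notin\mathcal{I}$ whenever $X,Y\subseteq\mathbf{N}$ are infinite sets with $X\le Y$ and $Y\notin\mathcal{I}$. An ideal $\mathcal{I}$ is strechable if $kA\notin\mathcal{I}$ for all $k\in\mathbf{N}$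 and all $A\notin\mathcal{I}$. *)

theory Defs
  imports "HOL-Analysis.Analysis" "HOL-Library.Infinite_Set" "HOL-Library.Extended_Real"
begin

abbreviation pos_nats :: "nat set" where
  "pos_nats \<equiv> {0<..}"

definition set_ideal :: "nat set set \<Rightarrow> bool" where
  "set_ideal I \<longleftrightarrow>
     I \<subseteq> Pow pos_nats \<and>
     (\<forall>A\<in>I. \<forall>B\<in>I. A \<union> B \<in> I) \<and>
     (\<forall>A\<in>I. \<forall>B. B \<subseteq> A \<longrightarrow> B \<in> I) \<and>
     (\<forall>A. A \<subseteq> pos_nats \<and> finite A \<longrightarrow> A \<in> I) \<and>
     I \<noteq> Pow pos_nats"

text \<open>The canonical enumeration of an infinite set, indexed from 1; the library's
  \<^const>\<open>enumerate\<close> is indexed from 0. It is only meaningful for infinite sets.\<close>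

definition nth_elem :: "nat set \<Rightarrow> nat \<Rightarrow> nat" where
  "nth_elem A n = enumerate A (n - 1)"

definition set_le :: "nat set \<Rightarrow> nat set \<Rightarrow> bool" where
  "set_le A B \<longleftrightarrow> (\<forall>n\<in>pos_nats. nth_elem A n \<le> nth_elem B n)"

definition subset_at :: "nat set \<Rightarrow> nat set \<Rightarrow> nat set" where
  "subset_at A B = nth_elem A ` B"

definition nonzero_density :: "nat set \<Rightarrow> bool" where
  "nonzero_density A \<longleftrightarrow>
     (\<exists>d>0. (\<lambda>n. real (card (A \<inter> {1..n})) / real n) \<longlonglongrightarrow> d)"

text \<open>In the next two definitions, the sets to which \<^const>\<open>subset_at\<close> is applied are
  automatically infinite: \<open>A\<close> because its density is positive, and \<open>B\<close> because an ideal
  contains all finite sets.\<close>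

definition weakly_thinnable :: "nat set set \<Rightarrow> bool" where
  "weakly_thinnable I \<longleftrightarrow> set_ideal I \<and>
     (\<forall>A B. A \<subseteq> pos_nats \<and> nonzero_density A \<and> B \<subseteq> pos_nats \<and> B \<notin> I
        \<longrightarrow> subset_at A B \<notin> I)"

definition thinnable :: "nat set set \<Rightarrow> bool" where
  "thinnable I \<longleftrightarrow> weakly_thinnable I \<and>
     (\<forall>A B. A \<subseteq> pos_nats \<and> nonzero_density A \<and> B \<subseteq> pos_nats \<and> B \<notin> I
        \<longrightarrow> subset_at B A \<notin> I) \<and>
     (\<forall>X Y. X \<subseteq> pos_nats \<and> infinite X \<and> Y \<subseteq> pos_nats \<and> infinite Y \<and> set_le X Y \<and> Y \<notin> I
        \<longrightarrow> X \<notin> I)"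

definition strechable :: "nat set set \<Rightarrow> bool" where
  "strechable I \<longleftrightarrow> set_ideal I \<and>
     (\<forall>k\<in>pos_nats. \<forall>A. A \<subseteq> pos_nats \<and> A \<notin> I \<longrightarrow> (\<lambda>a. k * a) ` A \<notin> I)"

text \<open>For \<open>f\<close> positive on \<^term>\<open>pos_nats\<close>, summability on \<open>S\<close> means that the sum over \<open>S\<close>
  is finite.\<close>

definition summable_ideal :: "(nat \<Rightarrow> real) \<Rightarrow> nat set set" where
  "summable_ideal f = {S. S \<subseteq> pos_nats \<and> f summable_on S}"

definition erdos_ulam_ideal :: "(nat \<Rightarrow> real) \<Rightarrow> nat set set" where
  "erdos_ulam_ideal f = {S. S \<subseteq> pos_nats \<and>
     (\<lambda>n. (\<Sum>i\<in>S \<inter> {1..n}. f i) / (\<Sum>i\<in>{1..n}. f i)) \<longlonglongrightarrow> 0}"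

end

theory Submission
  imports Defs
begin

text \<open>A weight that is eventually non-increasing gives more to smaller numbers. Hence, if the
  elements of a set in the ideal are moved upwards, one by one and injectively, the resulting
  set is lighter up to finitely many elements, and so it stays in the ideal. For the summable
  ideal this is the comparison test. For the Erdos--Ulam ideal it is a comparison of the partial
  weights on \<open>[1,n]\<close>, which only grow when elements move down, together with the divergence of
  the denominators. This closure property is \<open>shift_closed\<close>.

  The second half is about arbitrary ideals: a strechable ideal with this property is thinnable
  (\<open>strechable_shift_closed_imp_thinnable\<close>). If \<open>A\<close> has positive density, then
  \<open>a\<^sub>n \<le> k n\<close> for a fixed \<open>k\<close> and all \<open>n \<ge> 1\<close>. So \<open>A\<^sub>B\<close> lies below \<open>k B\<close>, which is
  outside the ideal by strechability. Similarly \<open>B\<^sub>A\<close> lies below each of the sets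
  \<open>{b\<^bsub>kn+j\<^esub> : n \<ge> 1}\<close> with \<open>j < k\<close>; if \<open>B\<^sub>A\<close> were in the ideal, so would be these sets and
  hence \<open>B\<close>, their union up to a finite set. The monotonicity condition on \<open>X \<le> Y\<close> is the
  closure property for the two canonical enumerations.\<close>

section \<open>Enumerating a set of positive integers\<close>

lemma nth_elem_in: "infinite A \<Longrightarrow> nth_elem A n \<in> A"
  by (simp add: nth_elem_def enumerate_in_set)

lemma nth_elem_pos: "infinite A \<Longrightarrow> A \<subseteq> pos_nats \<Longrightarrow> 0 < nth_elem A n"
  using nth_elem_in[of A n] by blast

lemma nth_elem_mono: "infinite A \<Longrightarrow> m \<le> n \<Longrightarrow> nth_elem A m \<le> nth_elem A n"
  unfolding nth_elem_def by (simp add: enumerate_mono_le_iff)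

lemma nth_elem_inj: "infinite A \<Longrightarrow> inj_on (nth_elem A) pos_nats"
proof (rule inj_onI)
  fix m n assume A: "infinite A" and m: "m \<in> pos_nats" and n: "n \<in> pos_nats"
    and eq: "nth_elem A m = nth_elem A n"
  have "m - 1 = n - 1"
    using eq injD[OF strict_mono_imp_inj_on[OF strict_mono_enumerate[OF A]]]
    unfolding nth_elem_def by blast
  then show "m = n" using m n by simp
qed

lemma nth_elem_range: "infinite A \<Longrightarrow> nth_elem A ` pos_nats = A"
proof -
  assume A: "infinite A"
  have "a \<in> nth_elem A ` pos_nats" if "a \<in> A" for a
  proof -
    obtain n where "enumerate A n = a"
      using enumerate_Ex[OF A \<open>a \<in> A\<close>] by blast
    then have "a = nth_elem A (Suc n)" by (simp add: nth_elem_def)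
    then show ?thesis by blast
  qed
  then show ?thesis using nth_elem_in[OF A] by blast
qed

lemma card_up_to_enumerate:
  assumes "infinite A" "A \<subseteq> pos_nats"
  shows "card (A \<inter> {1..enumerate A n}) = Suc n"
proof -
  have "A \<inter> {1..enumerate A n} = enumerate A ` {..n}"
  proof (intro equalityI subsetI)
    fix a assume a: "a \<in> A \<inter> {1..enumerate A n}"
    then obtain m where "enumerate A m = a"
      using enumerate_Ex[OF assms(1)] by blast
    then show "a \<in> enumerate A ` {..n}"
      using a assms(1) by (auto simp: enumerate_mono_le_iff)
  next
    fix a assume "a \<in> enumerate A ` {..n}"
    then show "a \<in> A \<inter> {1..enumerate A n}"
      using assms(1) enumerate_in_set[OF assms(1)] subsetD[OF assms(2)]
      by (auto simp: enumerate_mono_le_iff Suc_le_eq)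
  qed
  moreover have "inj_on (enumerate A) {..n}"
    using assms(1) by (meson strict_mono_enumerate strict_mono_imp_inj_on inj_on_subset subset_UNIV)
  ultimately show ?thesis by (simp add: card_image)
qed

section \<open>Sets of non-zero density grow linearly\<close>

lemma nonzero_density_imp_infinite:
  assumes "nonzero_density A"
  shows "infinite A"
proof
  assume A: "finite A"
  obtain d where d: "d > 0" "(\<lambda>n. real (card (A \<inter> {1..n})) / real n) \<longlonglongrightarrow> d"
    using assms unfolding nonzero_density_def by blast
  have "(\<lambda>n. real (card (A \<inter> {1..n})) / real n) \<longlonglongrightarrow> 0"
  proof (rule real_tendsto_sandwich[OF _ _ tendsto_const])
    show "\<forall>\<^sub>F n in sequentially. real (card (A \<inter> {1..n})) / real n \<le> real (card A) / real n"
      using A by (intro always_eventually allI divide_right_mono) (simp_all add: card_mono)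
    show "(\<lambda>n. real (card A) / real n) \<longlonglongrightarrow> 0"
      by (rule lim_const_over_n)
  qed auto
  then have "d = 0" by (rule LIMSEQ_unique[OF d(2)])
  with d(1) show False by simp
qed

text \<open>Along the elements of \<open>A\<close> the counting ratio is \<open>n / a\<^sub>n\<close>, so \<open>a\<^sub>n / n\<close> converges to
  the inverse of the density; being convergent, it is bounded.\<close>

lemma nonzero_density_linear_bound:
  assumes A: "A \<subseteq> pos_nats" and dens: "nonzero_density A"
  shows "\<exists>k>0. \<forall>n>0. nth_elem A n \<le> k * n"
proof -
  have inf: "infinite A" using nonzero_density_imp_infinite[OF dens] .
  obtain d where d: "d > 0" "(\<lambda>n. real (card (A \<inter> {1..n})) / real n) \<longlonglongrightarrow> d"
    using dens unfolding nonzero_density_def by blast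
  \<comment> \<open>The enumeration starts at index 0, so exactly \<open>Suc n\<close> elements are counted at
    \<open>enumerate A n\<close>.\<close>
  have "(\<lambda>n. real (card (A \<inter> {1..enumerate A n})) / real (enumerate A n)) \<longlonglongrightarrow> d"
    using LIMSEQ_subseq_LIMSEQ[OF d(2) strict_mono_enumerate[OF inf]] by (simp add: o_def)
  then have "(\<lambda>n. inverse (real (Suc n) / real (enumerate A n))) \<longlonglongrightarrow> inverse d"
    unfolding card_up_to_enumerate[OF inf A] using d(1) by (intro tendsto_inverse) auto
  then have "Bseq (\<lambda>n. inverse (real (Suc n) / real (enumerate A n)))"
    by (intro convergent_imp_Bseq) (auto simp: convergent_def)
  then obtain K where K: "\<And>n. norm (inverse (real (Suc n) / real (enumerate A n))) \<le> K"
    unfolding Bseq_def by blast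
  define k where "k = Suc (nat \<lceil>K\<rceil>)"
  have "nth_elem A n \<le> k * n" if "n > 0" for n
  proof -
    obtain m where m: "n = Suc m" using \<open>n > 0\<close> gr0_conv_Suc by blast
    have "real (enumerate A m) / real (Suc m) \<le> K"
      using K[of m] by simp
    also have "K \<le> real k" unfolding k_def by linarith
    finally have "real (enumerate A m) \<le> real k * real (Suc m)"
      by (simp add: pos_divide_le_eq del: of_nat_Suc)
    then have "real (enumerate A m) \<le> real (k * Suc m)"
      by (simp only: of_nat_mult)
    then show ?thesis unfolding m nth_elem_def of_nat_le_iff by simp
  qed
  moreover have "k > 0" by (simp add: k_def)
  ultimately show ?thesis by (intro exI[of _ k]) simp
qed

section \<open>Ideals that are closed under moving elements upwards\<close>

lemma set_ideal_subset: "set_ideal I \<Longrightarrow> A \<in> I \<Longrightarrow> B \<subseteq> A \<Longrightarrow> B \<in> I"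
  unfolding set_ideal_def by blast

lemma set_ideal_Un: "set_ideal I \<Longrightarrow> A \<in> I \<Longrightarrow> B \<in> I \<Longrightarrow> A \<union> B \<in> I"
  unfolding set_ideal_def by blast

lemma set_ideal_finite: "set_ideal I \<Longrightarrow> finite A \<Longrightarrow> A \<subseteq> pos_nats \<Longrightarrow> A \<in> I"
  unfolding set_ideal_def by blast

lemma set_ideal_infinite: "set_ideal I \<Longrightarrow> B \<subseteq> pos_nats \<Longrightarrow> B \<notin> I \<Longrightarrow> infinite B"
  using set_ideal_finite by blast

lemma set_ideal_UN:
  assumes I: "set_ideal I" and J: "finite J" and S: "\<And>j. j \<in> J \<Longrightarrow> S j \<in> I"
  shows "(\<Union>j\<in>J. S j) \<in> I"
  using J S
proof (induction J rule: finite_induct)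
  case empty
  then show ?case by (simp add: set_ideal_finite[OF I])
next
  case (insert j J)
  then show ?case by (simp add: set_ideal_Un[OF I])
qed

text \<open>The sets being compared are given as families over a common index set, which need not be
  enumerated in increasing order. This allows comparisons such as \<open>a\<^sub>b \<le> k b\<close> over \<open>b \<in> B\<close>
  without computing the canonical enumeration of \<open>A\<^sub>B\<close> or \<open>k B\<close>.\<close>

definition shift_closed :: "nat set set \<Rightarrow> bool" where
  "shift_closed I \<longleftrightarrow>
     (\<forall>(J :: nat set) x y. inj_on x J \<longrightarrow> inj_on y J \<longrightarrow> (\<forall>i\<in>J. 0 < x i \<and> x i \<le> y i) \<longrightarrow>
        x ` J \<in> I \<longrightarrow> y ` J \<in> I)"

lemma shift_closedD:
  fixes x y :: "nat \<Rightarrow> nat"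
  assumes "shift_closed I" "inj_on x J" "inj_on y J"
    and "\<And>i. i \<in> J \<Longrightarrow> 0 < x i" "\<And>i. i \<in> J \<Longrightarrow> x i \<le> y i" "x ` J \<in> I"
  shows "y ` J \<in> I"
  using assms unfolding shift_closed_def by blast

text \<open>An injective family takes values below \<open>n0\<close> only finitely often, and an ideal does
  not see finite sets. It is therefore enough to look at the range where a given eventually
  non-increasing weight is monotone.\<close>

lemma shift_closedI:
  fixes n0 :: nat
  assumes I: "set_ideal I"
    and shift: "\<And>(J :: nat set) x y. inj_on x J \<Longrightarrow> inj_on y J \<Longrightarrow> (\<And>i. i \<in> J \<Longrightarrow> 0 < x i) \<Longrightarrow>
      (\<And>i. i \<in> J \<Longrightarrow> n0 \<le> x i) \<Longrightarrow> (\<And>i. i \<in> J \<Longrightarrow> x i \<le> y i) \<Longrightarrow> x ` J \<in> I \<Longrightarrow> y ` J \<in> I"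
  shows "shift_closed I"
  unfolding shift_closed_def
proof (intro allI impI)
  fix J :: "nat set" and x y :: "nat \<Rightarrow> nat"
  assume x: "inj_on x J" and y: "inj_on y J" and le: "\<forall>i\<in>J. 0 < x i \<and> x i \<le> y i"
    and xI: "x ` J \<in> I"
  define L where "L = {i \<in> J. x i < n0}"
  have "finite (x ` L)" by (rule finite_subset[of _ "{..<n0}"]) (auto simp: L_def)
  moreover have "inj_on x L" using x by (rule inj_on_subset) (auto simp: L_def)
  ultimately have "finite L" by (rule finite_imageD)
  moreover have "y ` L \<subseteq> pos_nats" using le by (fastforce simp: L_def)
  ultimately have "y ` L \<in> I" by (intro set_ideal_finite[OF I]) simp_all
  moreover have "y ` (J - L) \<in> I"
  proof (rule shift[of x])
    have "x ` (J - L) \<subseteq> x ` J" by blast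
    with xI show "x ` (J - L) \<in> I" by (rule set_ideal_subset[OF I])
    show "inj_on x (J - L)" "inj_on y (J - L)" using x y by (auto simp: inj_on_diff)
  qed (use le in \<open>auto simp: L_def\<close>)
  ultimately have "y ` L \<union> y ` (J - L) \<in> I" by (rule set_ideal_Un[OF I])
  moreover have "y ` L \<union> y ` (J - L) = y ` J" by (auto simp: L_def)
  ultimately show "y ` J \<in> I" by simp
qed

text \<open>If \<open>a\<^sub>n \<le> k n\<close>, then \<open>A\<^sub>B\<close> lies below \<open>k B\<close>, term by term.\<close>

lemma shift_closed_subset_at_left:
  assumes I: "strechable I" "shift_closed I"
    and A: "A \<subseteq> pos_nats" "nonzero_density A" and B: "B \<subseteq> pos_nats" "B \<notin> I"
  shows "subset_at A B \<notin> I"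
proof
  assume "subset_at A B \<in> I"
  have inf: "infinite A" using nonzero_density_imp_infinite[OF A(2)] .
  obtain k where k: "k > 0" "\<And>n. n > 0 \<Longrightarrow> nth_elem A n \<le> k * n"
    using nonzero_density_linear_bound[OF A] by blast
  have "(\<lambda>b. k * b) ` B \<in> I"
  proof (rule shift_closedD[OF I(2), of "nth_elem A"])
    show "inj_on (nth_elem A) B" using nth_elem_inj[OF inf] B(1) by (rule inj_on_subset)
    show "inj_on (\<lambda>b. k * b) B" using k(1) by (simp add: inj_on_def)
    show "nth_elem A ` B \<in> I" using \<open>subset_at A B \<in> I\<close> by (simp add: subset_at_def)
    fix b assume "b \<in> B"
    then have "b > 0" using B(1) by blast
    then show "nth_elem A b \<le> k * b" by (rule k(2))
    show "0 < nth_elem A b" using nth_elem_pos[OF inf A(1)] .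
  qed
  moreover have "k \<in> pos_nats" using k(1) by simp
  ultimately show False using I(1) B unfolding strechable_def by metis
qed

text \<open>If \<open>a\<^sub>n \<le> k n\<close>, then \<open>b\<close> at index \<open>a\<^sub>n\<close> is at most \<open>b\<close> at each of the indices
  \<open>k n + j\<close> with \<open>j < k\<close>. Hence each residue class of indices of \<open>B\<close> modulo \<open>k\<close> lies above
  \<open>B\<^sub>A\<close> term by term, and \<open>B\<close> is the union of these \<open>k\<close> classes and a finite set.\<close>

lemma shift_closed_subset_at_right:
  assumes I: "set_ideal I" "shift_closed I"
    and A: "A \<subseteq> pos_nats" "nonzero_density A" and B: "B \<subseteq> pos_nats" "B \<notin> I"
  shows "subset_at B A \<notin> I"
proof
  assume BA: "subset_at B A \<in> I"
  have infA: "infinite A" using nonzero_density_imp_infinite[OF A(2)] .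
  have infB: "infinite B" using set_ideal_infinite[OF I(1) B] .
  obtain k where k: "k > 0" "\<And>n. n > 0 \<Longrightarrow> nth_elem A n \<le> k * n"
    using nonzero_density_linear_bound[OF A] by blast
  \<comment> \<open>Indices below \<open>k\<close> are left out, since their quotient 0 is not an index into \<open>A\<close>.\<close>
  define J where "J j = {m. k \<le> m \<and> m mod k = j}" for j
  have Jpos: "m div k > 0" if "m \<in> J j" for m j
    using that k(1) by (simp add: J_def div_greater_zero_iff)
  have class_in: "nth_elem B ` J j \<in> I" for j
  proof (rule shift_closedD[OF I(2), of "\<lambda>m. nth_elem B (nth_elem A (m div k))"])
    show "inj_on (\<lambda>m. nth_elem B (nth_elem A (m div k))) (J j)"
    proof (rule inj_onI)
      fix m n assume mn: "m \<in> J j" "n \<in> J j"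
        and eq: "nth_elem B (nth_elem A (m div k)) = nth_elem B (nth_elem A (n div k))"
      have "nth_elem A (m div k) = nth_elem A (n div k)"
        by (rule inj_onD[OF nth_elem_inj[OF infB] eq]) (simp_all add: nth_elem_pos[OF infA A(1)])
      then have "m div k = n div k"
        by (rule inj_onD[OF nth_elem_inj[OF infA]]) (use Jpos mn in simp_all)
      moreover have "m mod k = n mod k" using mn by (simp add: J_def)
      ultimately show "m = n" by (metis div_mult_mod_eq)
    qed
    show "inj_on (nth_elem B) (J j)"
      using nth_elem_inj[OF infB] by (rule inj_on_subset) (use k(1) in \<open>auto simp: J_def\<close>)
    have "(\<lambda>m. nth_elem B (nth_elem A (m div k))) ` J j \<subseteq> subset_at B A"
      unfolding subset_at_def using nth_elem_in[OF infA] by blast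
    with BA show "(\<lambda>m. nth_elem B (nth_elem A (m div k))) ` J j \<in> I"
      by (rule set_ideal_subset[OF I(1)])
    fix m assume m: "m \<in> J j"
    show "0 < nth_elem B (nth_elem A (m div k))" using nth_elem_pos[OF infB B(1)] .
    have "nth_elem A (m div k) \<le> k * (m div k)" using k(2) Jpos[OF m] by blast
    also have "\<dots> \<le> m" by simp
    finally show "nth_elem B (nth_elem A (m div k)) \<le> nth_elem B m"
      by (rule nth_elem_mono[OF infB])
  qed
  have "nth_elem B ` {1..<k} \<in> I"
    using nth_elem_pos[OF infB B(1)] by (intro set_ideal_finite[OF I(1)]) auto
  then have "nth_elem B ` {1..<k} \<union> (\<Union>j\<in>{..<k}. nth_elem B ` J j) \<in> I"
    using class_in by (intro set_ideal_Un[OF I(1)] set_ideal_UN[OF I(1)]) simp_all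
  moreover have "B \<subseteq> nth_elem B ` {1..<k} \<union> (\<Union>j\<in>{..<k}. nth_elem B ` J j)"
  proof
    fix b assume "b \<in> B"
    then obtain m where m: "b = nth_elem B m" "m > 0"
      using nth_elem_range[OF infB] by (metis greaterThan_iff imageE)
    have "m \<in> {1..<k} \<or> m \<in> J (m mod k) \<and> m mod k < k"
      using m(2) k(1) by (auto simp: J_def)
    with m(1) show "b \<in> nth_elem B ` {1..<k} \<union> (\<Union>j\<in>{..<k}. nth_elem B ` J j)" by blast
  qed
  ultimately have "B \<in> I" by (rule set_ideal_subset[OF I(1)])
  with B(2) show False ..
qed

theorem strechable_shift_closed_imp_thinnable:
  assumes str: "strechable I" and shift: "shift_closed I"
  shows "thinnable I"
proof -
  have I: "set_ideal I" using str by (simp add: strechable_def)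
  have "X \<notin> I" if X: "X \<subseteq> pos_nats" "infinite X" and Y: "Y \<subseteq> pos_nats" "infinite Y" "Y \<notin> I"
    and le: "set_le X Y" for X Y
  proof
    assume "X \<in> I"
    have "nth_elem Y ` pos_nats \<in> I"
    proof (rule shift_closedD[OF shift, of "nth_elem X"])
      show "nth_elem X ` pos_nats \<in> I" using \<open>X \<in> I\<close> nth_elem_range[OF X(2)] by simp
      show "inj_on (nth_elem X) pos_nats" "inj_on (nth_elem Y) pos_nats"
        using nth_elem_inj X(2) Y(2) by blast+
      fix n :: nat assume n: "n \<in> pos_nats"
      show "0 < nth_elem X n" using nth_elem_pos[OF X(2,1)] .
      show "nth_elem X n \<le> nth_elem Y n" using le n unfolding set_le_def by blast
    qed
    then show False using Y(3) nth_elem_range[OF Y(2)] by simp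
  qed
  then show ?thesis
    unfolding thinnable_def weakly_thinnable_def
    using I shift_closed_subset_at_left[OF str shift] shift_closed_subset_at_right[OF I shift]
    by blast
qed

section \<open>Summable and Erdos--Ulam ideals of an eventually non-increasing weight\<close>

lemma antimono_from:
  fixes f :: "nat \<Rightarrow> real"
  assumes "\<And>n. n0 \<le> n \<Longrightarrow> f (n + 1) \<le> f n" "n0 \<le> m" "m \<le> n"
  shows "f n \<le> f m"
  using assms(3,1,2) by (induction n rule: dec_induct) (auto intro: order_trans)

lemma set_ideal_summable_ideal:
  fixes f :: "nat \<Rightarrow> real"
  assumes div: "\<not> f summable_on pos_nats"
  shows "set_ideal (summable_ideal f)"
proof -
  have union: "f summable_on (A \<union> B)" if "f summable_on A" "f summable_on B" for A B
  proof -
    have "f summable_on (B - A)" using that(2) by (rule summable_on_subset_banach) auto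
    then have "f summable_on (A \<union> (B - A))"
      using that(1) by (intro summable_on_Un_disjoint) auto
    then show ?thesis by simp
  qed
  show ?thesis
    unfolding set_ideal_def
  proof (intro conjI)
    show "summable_ideal f \<noteq> Pow pos_nats"
      using div unfolding summable_ideal_def by blast
  qed (auto simp: summable_ideal_def union intro: summable_on_subset_banach)
qed

lemma shift_closed_summable_ideal:
  fixes f :: "nat \<Rightarrow> real"
  assumes pos: "\<And>n. n > 0 \<Longrightarrow> 0 < f n"
    and dec: "\<And>n. n0 \<le> n \<Longrightarrow> f (n + 1) \<le> f n"
    and div: "\<not> f summable_on pos_nats"
  shows "shift_closed (summable_ideal f)"
proof (rule shift_closedI[OF set_ideal_summable_ideal[OF div], of n0])
  fix J :: "nat set" and x y :: "nat \<Rightarrow> nat"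
  assume inj: "inj_on x J" "inj_on y J" and x0: "\<And>i. i \<in> J \<Longrightarrow> 0 < x i"
    and xn0: "\<And>i. i \<in> J \<Longrightarrow> n0 \<le> x i" and le: "\<And>i. i \<in> J \<Longrightarrow> x i \<le> y i"
    and xI: "x ` J \<in> summable_ideal f"
  have "(f \<circ> x) summable_on J"
    using xI inj(1) by (simp add: summable_ideal_def summable_on_reindex)
  then have "(f \<circ> y) summable_on J"
  proof (rule summable_on_comparison_test)
    fix i assume i: "i \<in> J"
    show "(f \<circ> y) i \<le> (f \<circ> x) i"
      using antimono_from[of n0 f, OF dec xn0[OF i] le[OF i]] by simp
    show "0 \<le> (f \<circ> y) i" using pos[of "y i"] x0[OF i] le[OF i] by simp
  qed
  moreover have "y ` J \<subseteq> pos_nats" using x0 le by fastforce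
  ultimately show "y ` J \<in> summable_ideal f"
    using inj(2) by (simp add: summable_ideal_def summable_on_reindex)
qed

lemma partial_sums_at_top:
  fixes f :: "nat \<Rightarrow> real"
  assumes pos: "\<And>n. n > 0 \<Longrightarrow> 0 < f n" and div: "\<not> f summable_on pos_nats"
  shows "filterlim (\<lambda>n. \<Sum>i\<in>{1..n}. f i) at_top sequentially"
proof (rule ccontr)
  assume not_top: "\<not> ?thesis"
  have mono: "(\<Sum>i\<in>{1..m}. f i) \<le> (\<Sum>i\<in>{1..n}. f i)" if "m \<le> n" for m n
    using that pos by (intro sum_mono2) (auto simp: less_imp_le)
  obtain Z where Z: "\<And>N. \<exists>n\<ge>N. (\<Sum>i\<in>{1..n}. f i) < Z"
    using not_top unfolding filterlim_at_top eventually_sequentially by (metis not_le)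
  have bound: "(\<Sum>i\<in>{1..n}. f i) \<le> Z" for n
    using Z[of n] mono by (meson less_imp_le order_trans)
  have "f summable_on pos_nats"
  proof (rule nonneg_bdd_above_summable_on)
    show "0 \<le> f n" if "n \<in> pos_nats" for n using pos that by (simp add: less_imp_le)
    show "bdd_above (sum f ` {F. F \<subseteq> pos_nats \<and> finite F})"
    proof (rule bdd_aboveI2)
      fix F assume "F \<in> {F. F \<subseteq> pos_nats \<and> finite F}"
      then have F: "F \<subseteq> pos_nats" "finite F" by auto
      have "F \<subseteq> {1..Max F}"
        using F Max_ge[OF F(2)] by (auto simp: Suc_le_eq)
      then have "sum f F \<le> (\<Sum>i\<in>{1..Max F}. f i)"
        using pos by (intro sum_mono2) (auto simp: less_imp_le)
      then show "sum f F \<le> Z" using bound order_trans by blast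
    qed
  qed
  with div show False ..
qed

text \<open>The majorant \<open>g\<close> may be the sum of two partial weights, for unions, or a constant, for
  finite sets, as well as the partial weight of a single set.\<close>

lemma erdos_ulam_ideal_dominated:
  fixes f :: "nat \<Rightarrow> real"
  assumes pos: "\<And>n. n > 0 \<Longrightarrow> 0 < f n" and S: "S \<subseteq> pos_nats"
    and bound: "\<And>n. (\<Sum>i\<in>S \<inter> {1..n}. f i) \<le> g n"
    and g: "(\<lambda>n. g n / (\<Sum>i\<in>{1..n}. f i)) \<longlonglongrightarrow> 0"
  shows "S \<in> erdos_ulam_ideal f"
proof -
  have nonneg: "0 \<le> (\<Sum>i\<in>T \<inter> {1..n}. f i)" for T n
    using pos by (intro sum_nonneg) (auto simp: less_imp_le)
  have nonneg': "0 \<le> (\<Sum>i\<in>{1..n}. f i)" for n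
    using nonneg[of UNIV n] by simp
  have "(\<lambda>n. (\<Sum>i\<in>S \<inter> {1..n}. f i) / (\<Sum>i\<in>{1..n}. f i)) \<longlonglongrightarrow> 0"
    by (rule real_tendsto_sandwich[OF _ _ tendsto_const g])
      (use bound nonneg nonneg' in \<open>auto intro!: always_eventually divide_right_mono divide_nonneg_nonneg\<close>)
  then show ?thesis using S by (simp add: erdos_ulam_ideal_def)
qed

lemma set_ideal_erdos_ulam_ideal:
  fixes f :: "nat \<Rightarrow> real"
  assumes pos: "\<And>n. n > 0 \<Longrightarrow> 0 < f n" and div: "\<not> f summable_on pos_nats"
  shows "set_ideal (erdos_ulam_ideal f)"
  unfolding set_ideal_def
proof (intro conjI ballI allI impI)
  show "erdos_ulam_ideal f \<subseteq> Pow pos_nats" by (auto simp: erdos_ulam_ideal_def)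
next
  fix A B assume AB: "A \<in> erdos_ulam_ideal f" "B \<in> erdos_ulam_ideal f"
  show "A \<union> B \<in> erdos_ulam_ideal f"
  proof (rule erdos_ulam_ideal_dominated[OF pos])
    show "A \<union> B \<subseteq> pos_nats" using AB by (auto simp: erdos_ulam_ideal_def)
    show "(\<Sum>i\<in>(A \<union> B) \<inter> {1..n}. f i) \<le> (\<Sum>i\<in>A \<inter> {1..n}. f i) + (\<Sum>i\<in>B \<inter> {1..n}. f i)" for n
    proof -
      have "0 \<le> (\<Sum>i\<in>(A \<inter> {1..n}) \<inter> (B \<inter> {1..n}). f i)"
        using pos by (intro sum_nonneg) (auto simp: less_imp_le)
      then show ?thesis
        unfolding Int_Un_distrib2 by (subst sum_Un) auto
    qed
    show "(\<lambda>n. ((\<Sum>i\<in>A \<inter> {1..n}. f i) + (\<Sum>i\<in>B \<inter> {1..n}. f i)) / (\<Sum>i\<in>{1..n}. f i)) \<longlonglongrightarrow> 0"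
      using AB unfolding add_divide_distrib erdos_ulam_ideal_def
      by (intro tendsto_add_zero) auto
  qed
next
  fix A B assume AB: "A \<in> erdos_ulam_ideal f" "B \<subseteq> A"
  show "B \<in> erdos_ulam_ideal f"
  proof (rule erdos_ulam_ideal_dominated[OF pos])
    show "(\<Sum>i\<in>B \<inter> {1..n}. f i) \<le> (\<Sum>i\<in>A \<inter> {1..n}. f i)" for n
      using AB(2) pos by (intro sum_mono2) (auto simp: less_imp_le)
  qed (use AB in \<open>auto simp: erdos_ulam_ideal_def\<close>)
next
  fix A assume A: "A \<subseteq> pos_nats \<and> finite A"
  show "A \<in> erdos_ulam_ideal f"
  proof (rule erdos_ulam_ideal_dominated[OF pos])
    show "(\<Sum>i\<in>A \<inter> {1..n}. f i) \<le> sum f A" for n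
      using A pos by (intro sum_mono2) (auto simp: less_imp_le)
    show "(\<lambda>n. sum f A / (\<Sum>i\<in>{1..n}. f i)) \<longlonglongrightarrow> 0"
      using partial_sums_at_top[OF pos div]
      by (intro tendsto_divide_0[OF tendsto_const] filterlim_at_top_imp_at_infinity)
  qed (use A in auto)
next
  have "pos_nats \<notin> erdos_ulam_ideal f"
  proof
    assume "pos_nats \<in> erdos_ulam_ideal f"
    moreover have "pos_nats \<inter> {1..n} = {1..n}" for n :: nat by auto
    ultimately have "(\<lambda>n. (\<Sum>i\<in>{1..n}. f i) / (\<Sum>i\<in>{1..n}. f i)) \<longlonglongrightarrow> 0"
      by (simp add: erdos_ulam_ideal_def)
    moreover have "(\<Sum>i\<in>{1..n}. f i) / (\<Sum>i\<in>{1..n}. f i) = 1" if "n \<ge> 1" for n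
    proof -
      have "0 < (\<Sum>i\<in>{1..n}. f i)" using pos that by (intro sum_pos) auto
      then show ?thesis by simp
    qed
    then have "(\<lambda>n. (\<Sum>i\<in>{1..n}. f i) / (\<Sum>i\<in>{1..n}. f i)) \<longlonglongrightarrow> 1"
      by (intro tendsto_eventually eventually_sequentiallyI[of 1])
    ultimately have "(0 :: real) = 1" by (rule LIMSEQ_unique)
    then show False by simp
  qed
  then show "erdos_ulam_ideal f \<noteq> Pow pos_nats" by blast
qed

text \<open>Whenever \<open>y\<^sub>i\<close> is counted in \<open>[1,n]\<close>, so is \<open>x\<^sub>i \<le> y\<^sub>i\<close>, and with at least the same
  weight; so the partial weights of the upper family never exceed those of the lower one.\<close>

lemma shift_closed_erdos_ulam_ideal:
  fixes f :: "nat \<Rightarrow> real"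
  assumes pos: "\<And>n. n > 0 \<Longrightarrow> 0 < f n"
    and dec: "\<And>n. n0 \<le> n \<Longrightarrow> f (n + 1) \<le> f n"
    and div: "\<not> f summable_on pos_nats"
  shows "shift_closed (erdos_ulam_ideal f)"
proof (rule shift_closedI[OF set_ideal_erdos_ulam_ideal[OF pos div], of n0])
  fix J :: "nat set" and x y :: "nat \<Rightarrow> nat"
  assume inj: "inj_on x J" "inj_on y J" and x0: "\<And>i. i \<in> J \<Longrightarrow> 0 < x i"
    and xn0: "\<And>i. i \<in> J \<Longrightarrow> n0 \<le> x i" and le: "\<And>i. i \<in> J \<Longrightarrow> x i \<le> y i"
    and xI: "x ` J \<in> erdos_ulam_ideal f"
  show "y ` J \<in> erdos_ulam_ideal f"
  proof (rule erdos_ulam_ideal_dominated[OF pos])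
    show "y ` J \<subseteq> pos_nats" using x0 le by fastforce
    show "(\<lambda>n. (\<Sum>i\<in>x ` J \<inter> {1..n}. f i) / (\<Sum>i\<in>{1..n}. f i)) \<longlonglongrightarrow> 0"
      using xI by (simp add: erdos_ulam_ideal_def)
    fix n
    define K where "K = {i \<in> J. y i \<le> n}"
    have K: "inj_on x K" "inj_on y K" using inj by (auto simp: K_def inj_on_def)
    have "y ` J \<inter> {1..n} = y ` K" using x0 le by (fastforce simp: K_def Suc_le_eq)
    then have "(\<Sum>i\<in>y ` J \<inter> {1..n}. f i) = (\<Sum>i\<in>K. f (y i))"
      using K(2) by (simp add: sum.reindex)
    also have "\<dots> \<le> (\<Sum>i\<in>K. f (x i))"
      by (rule sum_mono, rule antimono_from[of n0 f, OF dec]) (auto simp: K_def xn0 le)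
    also have "\<dots> = (\<Sum>i\<in>x ` K. f i)" using K(1) by (simp add: sum.reindex)
    also have "\<dots> \<le> (\<Sum>i\<in>x ` J \<inter> {1..n}. f i)"
    proof (rule sum_mono2)
      show "x ` K \<subseteq> x ` J \<inter> {1..n}"
        using x0 le by (fastforce simp: K_def Suc_le_eq intro: order_trans)
    qed (use pos in \<open>auto simp: less_imp_le\<close>)
    finally show "(\<Sum>i\<in>y ` J \<inter> {1..n}. f i) \<le> (\<Sum>i\<in>x ` J \<inter> {1..n}. f i)" .
  qed
qed

theorem proposition2p3:
  fixes f :: "nat \<Rightarrow> real"
  assumes "\<And>n. n \<in> pos_nats \<Longrightarrow> 0 < f n"
    and "\<exists>n0\<in>pos_nats. \<forall>n\<ge>n0. f (n + 1) \<le> f n"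
    and "\<not> f summable_on pos_nats"
  shows "set_ideal (summable_ideal f)
      \<and> (strechable (summable_ideal f) \<longrightarrow> thinnable (summable_ideal f))
      \<and> ((\<forall>k\<in>pos_nats.
            liminf (\<lambda>n. ereal ((\<Sum>i\<in>{1..n}. f i) / (\<Sum>i\<in>{1..k * n}. f i))) \<noteq> 0)
         \<longrightarrow> set_ideal (erdos_ulam_ideal f)
           \<and> (strechable (erdos_ulam_ideal f) \<longrightarrow> thinnable (erdos_ulam_ideal f)))"
proof -
  have pos: "\<And>n. n > 0 \<Longrightarrow> 0 < f n" using assms(1) by simp
  obtain n0 where dec: "\<And>n. n0 \<le> n \<Longrightarrow> f (n + 1) \<le> f n" using assms(2) by blast
  show ?thesis
    using set_ideal_summable_ideal[OF assms(3)] set_ideal_erdos_ulam_ideal[OF pos assms(3)]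
      strechable_shift_closed_imp_thinnable
      shift_closed_summable_ideal[OF pos dec assms(3)]
      shift_closed_erdos_ulam_ideal[OF pos dec assms(3)]
    by blast
qed

end
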